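(* Consider a theory of long (virtual) knots with two parities, i.e. one in which every chord of every Gauss diagram carries an index in $\mathbb{Z}_2\oplus\mathbb{Z}_2$ satisfying the parity axioms. For a Gauss diagram $G$ of a long knot $K$ let $w(K)=w(G)$ be the element of the group $D$ represented by the word of $G$ (see context for the word and for $D$). Then $w$ is an invariant of long knots valued in $D$: if $K$ and $K'$ are equivalent long knots in the theory with two parities, then $w(K)=w(K')$ as elements of $D$.
   Context: **Theory with two parities.** Long (virtual) knots are considered via Gauss diagrams on the oriented line: finitely many chords, each with an overcrossing end and an undercrossing end (and a sign), the chord ends being distinct points of the line. Diagrams are considered up to Reidemeister moves 1, 2, 3. In a third Reidemeister move, the six ends of the three chords form three pairs of adjacent ends, one pair for each two of the chords; in each pair the two ends exchange places; one pair consists of two overcrossing ends, one of two undercrossing ends, and one of an overcrossing end and an undercrossing end. Each chord of each diagram of the theory has an index in $\mathbb{Z}_2\oplus\mathbb{Z}_2$ (the pair of its two parities). The three non-trivial elements of this group are named $a,b,c$, and a chord with index zero is said to have trivial index. The parity axioms hold: - the chord of a first Reidemeister move has trivial index; - the two chords of a second Reidemeister move have equal index; - the indices of the three chords of a third Reidemeister move sum to zero (so if two chords of different non-trivial indices take part, the third chord has the third non-trivial index; if two chords have the same index, the third has trivial index), and corresponding chords before and after this move have the same index; - chords not taking part in a move keep their index. Two long knots are equivalent if their diagrams are connected by a finite sequence of Reidemeister moves in the theory. **The word $w(G)$.** Let $G$ be a Gauss diagram of a long knot in this theory. Letters are associated to the ends of chords of index $a$ and $b$ only. An undercrossing end of a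 chord of index $a$ gets letter $a$ or $a'$, an overcrossing end of such a chord gets $A$ or $A'$; similarly undercrossing ends of chords of index $b$ get $b$ or $b'$, and overcrossing ends get $B$ or $B'$. The prime is determined as follows. - For an undercrossing end of a chord of index $a$ or $b$: consider the opposite (overcrossing) end of the same chord, and count the undercrossing ends of chords of index $c$ which precede that opposite end on the line. Put a prime if and only if this number is odd. - For an overcrossing end of a chord of index $a$ or $b$: consider the opposite (undercrossing) end of the same chord, and count the overcrossing ends of chords of index $c$ which precede that opposite end on the line. Put a prime if and only if this number is odd. The word $w(G)$ is obtained by reading these letters from left to right along the line. Ends of chords of index $c$ and of trivial index contribute no letters. **The group $D$.** $D$ is the group generated by $a,a',b,b',A,A',B,B'$ with the relations: 1. $x^2=1$ for each of the eight generators $x$; 2. any two of $a,a',A,A'$ commute, and any two of $b,b',B,B'$ commute; 3. $[a,B]=[a,B']=[a',B]=[a',B']=[b,A]=[b,A']=[b',A]=[b',A']=1$; 4. $ab=b'a=ba'=a'b'$ and $ba=ab'=a'b=b'a'$; 5. $AB=B'A=BA'=A'B'$ and $BA=AB'=A'B=B'A'$. *)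

theory Defs
  imports "HOL-Algebra.Group" "HOL-Library.Z2" "HOL-Library.Product_Plus"
begin

section \<open>Groups given by generators and relations\<close>

text \<open>A letter \<open>(x, True)\<close> stands for the generator \<open>x\<close>, a letter \<open>(x, False)\<close> for its
  formal inverse.\<close>

type_synonym 'g group_word = "('g \<times> bool) list"

definition pos :: "'g list \<Rightarrow> 'g group_word" where
  "pos xs = map (\<lambda>x. (x, True)) xs"

inductive pres_eq :: "('g group_word \<times> 'g group_word) set \<Rightarrow> 'g group_word \<Rightarrow> 'g group_word \<Rightarrow> bool"
  for R where
  refl: "pres_eq R u u"
| sym: "pres_eq R u v \<Longrightarrow> pres_eq R v u"
| trans: "pres_eq R u v \<Longrightarrow> pres_eq R v w \<Longrightarrow> pres_eq R u w"
| subword: "pres_eq R u v \<Longrightarrow> pres_eq R (x @ u @ y) (x @ v @ y)"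
| cancel: "pres_eq R [(g, e), (g, \<not> e)] []"
| rel: "(u, v) \<in> R \<Longrightarrow> pres_eq R u v"

definition word_class ::
    "('g group_word \<times> 'g group_word) set \<Rightarrow> 'g group_word \<Rightarrow> 'g group_word set" where
  "word_class R u = {v. pres_eq R u v}"

definition presented_group ::
    "('g group_word \<times> 'g group_word) set \<Rightarrow> 'g group_word set monoid" where
  "presented_group R =
     \<lparr>carrier = range (word_class R),
      mult = (\<lambda>X Y. \<Union>u\<in>X. \<Union>v\<in>Y. word_class R (u @ v)),
      one = word_class R []\<rparr>"

lemma word_class_eq_iff: "word_class R u = word_class R v \<longleftrightarrow> pres_eq R u v"
  unfolding word_class_def
  by (blast intro: pres_eq.refl pres_eq.sym pres_eq.trans)

lemma pres_eq_append:
  assumes "pres_eq R u u'" and "pres_eq R v v'"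
  shows "pres_eq R (u @ v) (u' @ v')"
proof (rule pres_eq.trans)
  show "pres_eq R (u @ v) (u' @ v)"
    using pres_eq.subword[OF assms(1), of "[]" v] by simp
  show "pres_eq R (u' @ v) (u' @ v')"
    using pres_eq.subword[OF assms(2), of u' "[]"] by simp
qed

lemma presented_group_mult:
  "word_class R u \<otimes>\<^bsub>presented_group R\<^esub> word_class R v = word_class R (u @ v)"
proof -
  have "word_class R (u' @ v') = word_class R (u @ v)"
    if "u' \<in> word_class R u" "v' \<in> word_class R v" for u' v'
  proof -
    have "pres_eq R (u @ v) (u' @ v')"
      using that by (intro pres_eq_append) (simp_all add: word_class_def)
    then show ?thesis
      by (simp add: word_class_eq_iff pres_eq.sym)
  qed
  moreover have "u \<in> word_class R u" "v \<in> word_class R v"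
    by (simp_all add: word_class_def pres_eq.refl)
  ultimately have "(\<Union>u'\<in>word_class R u. \<Union>v'\<in>word_class R v. word_class R (u' @ v'))
      = word_class R (u @ v)"
    by blast
  then show ?thesis
    by (simp add: presented_group_def)
qed

lemma pres_eq_inverse: "pres_eq R (map (apsnd Not) (rev u) @ u) []"
proof (induction u)
  case Nil
  then show ?case by (simp add: pres_eq.refl)
next
  case (Cons p u)
  obtain g e where p: "p = (g, e)" by (cases p)
  have "pres_eq R (map (apsnd Not) (rev u) @ [(g, \<not> e), (g, \<not> \<not> e)] @ u)
                  (map (apsnd Not) (rev u) @ [] @ u)"
    by (rule pres_eq.subword, rule pres_eq.cancel)
  then have "pres_eq R (map (apsnd Not) (rev (p # u)) @ p # u) (map (apsnd Not) (rev u) @ u)"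
    by (simp add: p)
  then show ?case using Cons.IH by (rule pres_eq.trans)
qed

lemma group_presented_group: "group (presented_group R)"
proof (rule groupI)
  fix X assume "X \<in> carrier (presented_group R)"
  then obtain u where u: "X = word_class R u" by (auto simp: presented_group_def)
  show "\<exists>Y\<in>carrier (presented_group R). Y \<otimes>\<^bsub>presented_group R\<^esub> X = \<one>\<^bsub>presented_group R\<^esub>"
  proof
    show "word_class R (map (apsnd Not) (rev u)) \<otimes>\<^bsub>presented_group R\<^esub> X = \<one>\<^bsub>presented_group R\<^esub>"
      unfolding u presented_group_mult
      by (simp add: presented_group_def word_class_eq_iff pres_eq_inverse)
    show "word_class R (map (apsnd Not) (rev u)) \<in> carrier (presented_group R)"
      unfolding presented_group_def by auto
  qed
next
  have car: "carrier (presented_group R) = range (word_class R)"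
    and one: "\<one>\<^bsub>presented_group R\<^esub> = word_class R []"
    by (simp_all add: presented_group_def)
  show "\<one>\<^bsub>presented_group R\<^esub> \<in> carrier (presented_group R)" by (auto simp: car one)
  fix X Y Z
  show "\<one>\<^bsub>presented_group R\<^esub> \<otimes>\<^bsub>presented_group R\<^esub> X = X" if "X \<in> carrier (presented_group R)"
    using that by (auto simp: car one presented_group_mult)
  show "X \<otimes>\<^bsub>presented_group R\<^esub> Y \<in> carrier (presented_group R)"
    if "X \<in> carrier (presented_group R)" "Y \<in> carrier (presented_group R)"
    using that by (auto simp: car presented_group_mult)
  show "X \<otimes>\<^bsub>presented_group R\<^esub> Y \<otimes>\<^bsub>presented_group R\<^esub> Z
      = X \<otimes>\<^bsub>presented_group R\<^esub> (Y \<otimes>\<^bsub>presented_group R\<^esub> Z)"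
    if "X \<in> carrier (presented_group R)" "Y \<in> carrier (presented_group R)"
       "Z \<in> carrier (presented_group R)"
    using that by (auto simp: car presented_group_mult)
qed


section \<open>The group D\<close>

datatype gen = ga | ga' | gb | gb' | gA | gA' | gB | gB'

definition D_relations :: "(gen list \<times> gen list) set" where
  "D_relations =
     {([x, x], []) | x. True}
   \<union> {([x, y], [y, x]) | x y. x \<in> {ga, ga', gA, gA'} \<and> y \<in> {ga, ga', gA, gA'}}
   \<union> {([x, y], [y, x]) | x y. x \<in> {gb, gb', gB, gB'} \<and> y \<in> {gb, gb', gB, gB'}}
   \<union> {([x, y], [y, x]) | x y. x \<in> {ga, ga'} \<and> y \<in> {gB, gB'}}
   \<union> {([x, y], [y, x]) | x y. x \<in> {gb, gb'} \<and> y \<in> {gA, gA'}}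
   \<union> {([ga, gb], [gb', ga]), ([gb', ga], [gb, ga']), ([gb, ga'], [ga', gb'])}
   \<union> {([gb, ga], [ga, gb']), ([ga, gb'], [ga', gb]), ([ga', gb], [gb', ga'])}
   \<union> {([gA, gB], [gB', gA]), ([gB', gA], [gB, gA']), ([gB, gA'], [gA', gB'])}
   \<union> {([gB, gA], [gA, gB']), ([gA, gB'], [gA', gB]), ([gA', gB], [gB', gA'])}"

definition D_rels :: "(gen group_word \<times> gen group_word) set" where
  "D_rels = map_prod pos pos ` D_relations"

definition D :: "gen group_word set monoid" where
  "D = presented_group D_rels"

definition D_element :: "gen list \<Rightarrow> gen group_word set" where
  "D_element xs = word_class D_rels (pos xs)"


section \<open>Gauss diagrams of long virtual knots\<close>

text \<open>A Gauss diagram on the oriented line, up to orientation-preserving homeomorphism, is the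
  sequence of its chord ends read along the line. The natural numbers naming the chords are
  bookkeeping only; see \<open>relabelling\<close> below.\<close>

datatype level = Over | Under

fun opposite :: "level \<Rightarrow> level" where
  "opposite Over = Under"
| "opposite Under = Over"

record diagram =
  ends :: "(nat \<times> level) list"
  sign :: "nat \<Rightarrow> int"

definition chords :: "diagram \<Rightarrow> nat set" where
  "chords G = fst ` set (ends G)"

definition gauss_diagram :: "diagram \<Rightarrow> bool" where
  "gauss_diagram G \<longleftrightarrow>
     distinct (ends G) \<and> set (ends G) = chords G \<times> {Over, Under} \<and>
     (\<forall>x\<in>chords G. sign G x \<in> {1, -1})"

text \<open>An orientation-preserving homeomorphism of the line fixes the order of the ends, so two
  codes describe the same Gauss diagram iff they differ by renaming the chords. The field
  \<open>sign\<close> is irrelevant outside the set of chords.\<close>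

definition relabelling :: "(nat \<Rightarrow> nat) \<Rightarrow> diagram \<Rightarrow> diagram \<Rightarrow> bool" where
  "relabelling f G G' \<longleftrightarrow>
     inj_on f (chords G) \<and> ends G' = map (apfst f) (ends G) \<and>
     (\<forall>x\<in>chords G. sign G' (f x) = sign G x)"


section \<open>Reidemeister moves\<close>

text \<open>In the moves a chord that survives keeps its name. \<open>R1 p G G'\<close> and \<open>R2 p q G G'\<close> are the
  increasing moves, creating \<open>p\<close>, respectively \<open>p\<close> and \<open>q\<close>. All moves are used between
  Gauss diagrams only, so the new names are automatically fresh.\<close>

definition same_signs :: "diagram \<Rightarrow> diagram \<Rightarrow> bool" where
  "same_signs G G' \<longleftrightarrow> (\<forall>x\<in>chords G. sign G' x = sign G x)"

definition R1 :: "nat \<Rightarrow> diagram \<Rightarrow> diagram \<Rightarrow> bool" where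
  "R1 p G G' \<longleftrightarrow> same_signs G G' \<and>
     (\<exists>us vs l. ends G = us @ vs \<and> ends G' = us @ [(p, l), (p, opposite l)] @ vs)"

definition R2 :: "nat \<Rightarrow> nat \<Rightarrow> diagram \<Rightarrow> diagram \<Rightarrow> bool" where
  "R2 p q G G' \<longleftrightarrow> same_signs G G' \<and> sign G' q = - sign G' p \<and>
     (\<exists>us vs ws l P. ends G = us @ vs @ ws \<and>
        P \<in> {[(p, opposite l), (q, opposite l)], [(q, opposite l), (p, opposite l)]} \<and>
        ends G' = us @ [(p, l), (q, l)] @ vs @ P @ ws)"

text \<open>In the third move, \<open>p\<close>, \<open>q\<close>, \<open>r\<close> are the crossings of the top strand with the middle one,
  of the top strand with the bottom one, and of the middle strand with the bottom one.
  Let \<open>d\<^sub>1\<close>, \<open>d\<^sub>2\<close>, \<open>d\<^sub>3\<close> be the directions of the three (straight) strands from top to bottom.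
  The sign of the crossing of strand \<open>i\<close> over strand \<open>j\<close> is that of \<open>det (d\<^sub>i, d\<^sub>j)\<close>. Closing up the
  triangle formed by the three strands shows that the displacements from the first-named to the
  second-named crossing, from \<open>p\<close> to \<open>q\<close> along the top strand, from \<open>p\<close> to \<open>r\<close> along the middle one
  and from \<open>q\<close> to \<open>r\<close> along the bottom one, are \<open>\<tau>\<^sub>1 d\<^sub>1\<close>, \<open>\<tau>\<^sub>2 d\<^sub>2\<close>, \<open>\<tau>\<^sub>3 d\<^sub>3\<close> with
  \<open>(\<tau>\<^sub>1, \<tau>\<^sub>2, \<tau>\<^sub>3)\<close> proportional to \<open>(det (d\<^sub>2, d\<^sub>3), det (d\<^sub>1, d\<^sub>3), det (d\<^sub>1, d\<^sub>2))\<close>. Hence their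
  signs are the signs of \<open>r\<close>, \<open>q\<close>, \<open>p\<close>, up to a common sign \<open>s\<close> that the move reverses. The strands
  may occur in any order on the line.\<close>

definition strand :: "int \<Rightarrow> nat \<times> level \<Rightarrow> nat \<times> level \<Rightarrow> (nat \<times> level) list" where
  "strand s e e' = (if s = 1 then [e, e'] else [e', e])"

definition R3 :: "nat \<Rightarrow> nat \<Rightarrow> nat \<Rightarrow> diagram \<Rightarrow> diagram \<Rightarrow> bool" where
  "R3 p q r G G' \<longleftrightarrow> same_signs G G' \<and> distinct [p, q, r] \<and>
     (\<exists>s us vs ws zs X Y Z. s \<in> {1, -1} \<and>
        {X, Y, Z} = {strand (s * sign G r) (p, Over) (q, Over),
                     strand (s * sign G q) (p, Under) (r, Over),
                     strand (s * sign G p) (q, Under) (r, Under)} \<and>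
        ends G = us @ X @ vs @ Y @ ws @ Z @ zs \<and>
        ends G' = us @ rev X @ vs @ rev Y @ ws @ rev Z @ zs)"


section \<open>Theories with two parities\<close>

type_synonym index = "bit \<times> bit"

text \<open>\<open>T\<close> is the class of Gauss diagrams of the theory (for instance all of them, or those of
  classical long knots) and \<open>ind G x\<close> is the index of the chord \<open>x\<close> of \<open>G\<close>.\<close>

locale two_parity_theory =
  fixes T :: "diagram set" and ind :: "diagram \<Rightarrow> nat \<Rightarrow> index"
  assumes diagrams: "G \<in> T \<Longrightarrow> gauss_diagram G"
    and ind_relabelling: "G \<in> T \<Longrightarrow> G' \<in> T \<Longrightarrow> relabelling f G G' \<Longrightarrow> x \<in> chords G \<Longrightarrow>
           ind G' (f x) = ind G x"
    and ind_R1: "G \<in> T \<Longrightarrow> G' \<in> T \<Longrightarrow> R1 p G G' \<Longrightarrow> ind G' p = 0"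
    and ind_R1_other: "G \<in> T \<Longrightarrow> G' \<in> T \<Longrightarrow> R1 p G G' \<Longrightarrow> x \<in> chords G \<Longrightarrow> ind G' x = ind G x"
    and ind_R2: "G \<in> T \<Longrightarrow> G' \<in> T \<Longrightarrow> R2 p q G G' \<Longrightarrow> ind G' p = ind G' q"
    and ind_R2_other: "G \<in> T \<Longrightarrow> G' \<in> T \<Longrightarrow> R2 p q G G' \<Longrightarrow> x \<in> chords G \<Longrightarrow> ind G' x = ind G x"
    and ind_R3: "G \<in> T \<Longrightarrow> G' \<in> T \<Longrightarrow> R3 p q r G G' \<Longrightarrow> ind G p + ind G q + ind G r = 0"
    and ind_R3_same: "G \<in> T \<Longrightarrow> G' \<in> T \<Longrightarrow> R3 p q r G G' \<Longrightarrow> x \<in> chords G \<Longrightarrow> ind G' x = ind G x"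

definition elementary_step :: "diagram set \<Rightarrow> diagram \<Rightarrow> diagram \<Rightarrow> bool" where
  "elementary_step T G G' \<longleftrightarrow> G \<in> T \<and> G' \<in> T \<and>
     ((\<exists>f. relabelling f G G') \<or> (\<exists>p. R1 p G G') \<or> (\<exists>p q. R2 p q G G') \<or> (\<exists>p q r. R3 p q r G G'))"

definition equivalent_in :: "diagram set \<Rightarrow> diagram \<Rightarrow> diagram \<Rightarrow> bool" where
  "equivalent_in T = equivclp (elementary_step T)"


section \<open>The word of a Gauss diagram\<close>

text \<open>The index \<open>j\<close> of a chord is passed as a function so that the names \<open>\<alpha>\<close>, \<open>\<beta>\<close>, \<open>\<gamma>\<close> of the three
  non-trivial indices (a, b, c in the letters) remain arbitrary.\<close>

definition primed :: "index \<Rightarrow> (nat \<Rightarrow> index) \<Rightarrow> diagram \<Rightarrow> nat \<times> level \<Rightarrow> bool" where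
  "primed \<gamma> j G = (\<lambda>(x, l).
     odd (length (filter (\<lambda>(y, m). m = l \<and> j y = \<gamma>)
       (takeWhile (\<lambda>e. e \<noteq> (x, opposite l)) (ends G)))))"

fun letter_a :: "level \<Rightarrow> bool \<Rightarrow> gen" where
  "letter_a Under pr = (if pr then ga' else ga)"
| "letter_a Over pr = (if pr then gA' else gA)"

fun letter_b :: "level \<Rightarrow> bool \<Rightarrow> gen" where
  "letter_b Under pr = (if pr then gb' else gb)"
| "letter_b Over pr = (if pr then gB' else gB)"

definition end_word ::
    "index \<Rightarrow> index \<Rightarrow> index \<Rightarrow> (nat \<Rightarrow> index) \<Rightarrow> diagram \<Rightarrow> nat \<times> level \<Rightarrow> gen list" where
  "end_word \<alpha> \<beta> \<gamma> j G e =
     (if j (fst e) = \<alpha> then [letter_a (snd e) (primed \<gamma> j G e)]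
      else if j (fst e) = \<beta> then [letter_b (snd e) (primed \<gamma> j G e)]
      else [])"

definition word :: "index \<Rightarrow> index \<Rightarrow> index \<Rightarrow> (nat \<Rightarrow> index) \<Rightarrow> diagram \<Rightarrow> gen list" where
  "word \<alpha> \<beta> \<gamma> j G = concat (map (end_word \<alpha> \<beta> \<gamma> j G) (ends G))"

definition w :: "index \<Rightarrow> index \<Rightarrow> index \<Rightarrow> (nat \<Rightarrow> index) \<Rightarrow> diagram \<Rightarrow> gen group_word set" where
  "w \<alpha> \<beta> \<gamma> j G = D_element (word \<alpha> \<beta> \<gamma> j G)"

end

theory Submission
  imports Defs
begin

text \<open>
  Under a move the word changes only near the move, except possibly for primes, so the first
  point is to see which primes change. The prime of an end records a parity: the number of ends of
  \<open>\<gamma>\<close>-chords, of the same level as the given end, that lie before its opposite end. The first move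
  inserts no end of a \<open>\<gamma>\<close>-chord; the second inserts none, or at either place two adjacent ones on one level; so
  neither affects the primes of the old ends. In the third move only neighbours are exchanged, and
  a prime can change only if an end of one level passes an end of a \<open>\<gamma>\<close>-chord of the other level.
  This confines the change to the middle strand, the only one that carries ends of both levels:
  with \<open>p\<close>, \<open>q\<close>, \<open>r\<close> the crossings top/middle, top/bottom, middle/bottom, the over-end of \<open>p\<close>
  changes its prime iff \<open>r\<close> has index \<open>\<gamma>\<close>, and the under-end of \<open>r\<close> changes its prime iff \<open>p\<close> has
  index \<open>\<gamma>\<close> (\<open>primed_R3\<close>).

  In the third move the letters of each strand are exchanged. By the parity axiom the top strand
  carries an \<open>\<alpha>\<close>-letter and a \<open>\<beta>\<close>-letter exactly when \<open>r\<close> has index \<open>\<gamma>\<close> and \<open>p\<close> a letter at all,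
  that is, exactly when the exchange comes with a change of prime in one of the two letters; this is
  an instance of \<open>AB = BA'\<close> and its companions. The bottom strand is the mirror image, with
  \<open>p\<close> and \<open>r\<close> interchanged. On the middle strand no prime changes, and letters of different levels
  commute, as do any two letters of chords of equal index. So the word of each strand keeps its
  value in the group (\<open>word_R3\<close>).

  In the second move the two new ends in either place have the same level, the same index and, since
  their opposite ends are adjacent, the same prime; their letters cancel by \<open>x\<^sup>2 = 1\<close>.
\<close>

section \<open>Computing with positive words in the group\<close>

definition D_eq :: "gen list \<Rightarrow> gen list \<Rightarrow> bool" where
  "D_eq xs ys \<longleftrightarrow> pres_eq D_rels (pos xs) (pos ys)"

lemma D_element_eq_iff: "D_element xs = D_element ys \<longleftrightarrow> D_eq xs ys"
  by (simp add: D_element_def D_eq_def word_class_eq_iff)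

lemma D_eq_refl [simp]: "D_eq xs xs"
  by (simp add: D_eq_def pres_eq.refl)

lemma D_eq_sym: "D_eq xs ys \<Longrightarrow> D_eq ys xs"
  by (simp add: D_eq_def pres_eq.sym)

lemma D_eq_trans: "D_eq xs ys \<Longrightarrow> D_eq ys zs \<Longrightarrow> D_eq xs zs"
  unfolding D_eq_def by (rule pres_eq.trans)

lemma D_eq_append: "D_eq xs xs' \<Longrightarrow> D_eq ys ys' \<Longrightarrow> D_eq (xs @ ys) (xs' @ ys')"
  unfolding D_eq_def pos_def map_append by (rule pres_eq_append)

lemma D_eq_relation: "(xs, ys) \<in> D_relations \<Longrightarrow> D_eq xs ys"
  unfolding D_eq_def D_rels_def by (rule pres_eq.rel) (force simp: image_iff)

lemma D_eq_square: "D_eq [x, x] []"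
  by (rule D_eq_relation) (simp add: D_relations_def)

lemma D_eq_letter_a_commute: "D_eq [letter_a l s, letter_a m t] [letter_a m t, letter_a l s]"
  by (rule D_eq_relation) (cases l; cases m; simp add: D_relations_def)

lemma D_eq_letter_b_commute: "D_eq [letter_b l s, letter_b m t] [letter_b m t, letter_b l s]"
  by (rule D_eq_relation) (cases l; cases m; simp add: D_relations_def)

lemma D_eq_letter_ab_commute:
  assumes "l \<noteq> m"
  shows "D_eq [letter_a l s, letter_b m t] [letter_b m t, letter_a l s]"
    and "D_eq [letter_b m t, letter_a l s] [letter_a l s, letter_b m t]"
proof -
  show "D_eq [letter_a l s, letter_b m t] [letter_b m t, letter_a l s]"
  proof (cases l)
    case Under
    with assms have "m = Over" by (cases m) auto
    with Under show ?thesis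
      by (intro D_eq_relation) (simp add: D_relations_def)
  next
    case Over
    with assms have "m = Under" by (cases m) auto
    with Over show ?thesis
      by (intro D_eq_sym[OF D_eq_relation]) (simp add: D_relations_def)
  qed
  then show "D_eq [letter_b m t, letter_a l s] [letter_a l s, letter_b m t]"
    by (rule D_eq_sym)
qed

text \<open>The relations such as \<open>ab = b'a = ba'\<close> say that the letters of an \<open>a\<close>-chord and a \<open>b\<close>-chord on the same
  level change places at the cost of one prime, which either of the two letters may pay.\<close>

lemma D_eq_letter_ab_twist:
  shows "D_eq [letter_a l s, letter_b l t] [letter_b l t, letter_a l (\<not> s)]"
    and "D_eq [letter_a l s, letter_b l t] [letter_b l (\<not> t), letter_a l s]"
proof -
  have chain: "D_eq x y \<and> D_eq y z \<and> D_eq z u"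
    if "{(x, y), (y, z), (z, u)} \<subseteq> D_relations" for x y z u
    using that by (simp add: D_eq_relation)
  have "D_eq [ga, gb] [gb', ga] \<and> D_eq [gb', ga] [gb, ga'] \<and> D_eq [gb, ga'] [ga', gb']"
       "D_eq [gb, ga] [ga, gb'] \<and> D_eq [ga, gb'] [ga', gb] \<and> D_eq [ga', gb] [gb', ga']"
       "D_eq [gA, gB] [gB', gA] \<and> D_eq [gB', gA] [gB, gA'] \<and> D_eq [gB, gA'] [gA', gB']"
       "D_eq [gB, gA] [gA, gB'] \<and> D_eq [gA, gB'] [gA', gB] \<and> D_eq [gA', gB] [gB', gA']"
    by (rule chain, simp add: D_relations_def)+
  note r = this
  show "D_eq [letter_a l s, letter_b l t] [letter_b l t, letter_a l (\<not> s)]"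
    by (cases l; cases s; cases t; simp) (meson r D_eq_trans D_eq_sym)+
  show "D_eq [letter_a l s, letter_b l t] [letter_b l (\<not> t), letter_a l s]"
    by (cases l; cases s; cases t; simp) (meson r D_eq_trans D_eq_sym)+
qed

definition letters :: "index \<Rightarrow> index \<Rightarrow> index \<Rightarrow> level \<Rightarrow> bool \<Rightarrow> gen list" where
  "letters \<alpha> \<beta> i l s =
     (if i = \<alpha> then [letter_a l s] else if i = \<beta> then [letter_b l s] else [])"

lemma end_word_letters:
  "end_word \<alpha> \<beta> \<gamma> j G (x, l) = letters \<alpha> \<beta> (j x) l (primed \<gamma> j G (x, l))"
  by (simp add: end_word_def letters_def)

lemma D_eq_letters_square: "D_eq (letters \<alpha> \<beta> i l s @ letters \<alpha> \<beta> i l s) []"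
  by (simp add: letters_def D_eq_square)

text \<open>All exchanges of neighbouring ends in the third move are covered by one rule: a prime has to
  change exactly when an \<open>\<alpha>\<close>-letter and a \<open>\<beta>\<close>-letter of the same level are exchanged. The primes
  \<open>s\<close>, \<open>s'\<close>, \<open>t\<close>, \<open>t'\<close> of ends without a letter are unconstrained, because in the
  third move the prime of such an end may change as well.\<close>

lemma D_eq_letters_swap:
  assumes "if l = m \<and> {i, k} = {\<alpha>, \<beta>} then (s' = s) \<noteq> (t' = t)
           else (i \<in> {\<alpha>, \<beta>} \<longrightarrow> s' = s) \<and> (k \<in> {\<alpha>, \<beta>} \<longrightarrow> t' = t)"
    and "\<alpha> \<noteq> \<beta>"
  shows "D_eq (letters \<alpha> \<beta> i l s @ letters \<alpha> \<beta> k m t) (letters \<alpha> \<beta> k m t' @ letters \<alpha> \<beta> i l s')"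
proof -
  consider (aa) "i = \<alpha>" "k = \<alpha>" | (bb) "i = \<beta>" "k = \<beta>"
    | (ab) "i = \<alpha>" "k = \<beta>" | (ba) "i = \<beta>" "k = \<alpha>"
    | (none) "i \<notin> {\<alpha>, \<beta>} \<or> k \<notin> {\<alpha>, \<beta>}" by blast
  then show ?thesis
  proof cases
    case aa
    with assms show ?thesis by (auto simp: letters_def D_eq_letter_a_commute)
  next
    case bb
    with assms show ?thesis by (auto simp: letters_def D_eq_letter_b_commute)
  next
    case ab
    show ?thesis
    proof (cases "l = m")
      case True
      with ab assms have "s' = s \<and> t' = (\<not> t) \<or> s' = (\<not> s) \<and> t' = t" by auto
      then show ?thesis
        using ab True assms(2) D_eq_letter_ab_twist[of l s t] by (auto simp: letters_def)
    next
      case False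
      then show ?thesis
        using ab assms D_eq_letter_ab_commute[of l m] by (auto simp: letters_def)
    qed
  next
    case ba
    show ?thesis
    proof (cases "l = m")
      case True
      with ba assms have "s' = s \<and> t' = (\<not> t) \<or> s' = (\<not> s) \<and> t' = t"
        by (auto simp: insert_commute)
      then show ?thesis
        using ba True assms(2) D_eq_letter_ab_twist[of l t' s', THEN D_eq_sym]
        by (auto simp: letters_def)
    next
      case False
      then show ?thesis
        using ba assms D_eq_letter_ab_commute[of m l] by (auto simp: letters_def)
    qed
  next
    case none
    then have "{i, k} \<noteq> {\<alpha>, \<beta>}" by blast
    with none assms show ?thesis by (auto simp: letters_def)
  qed
qed


section \<open>Primes as parities of initial segments\<close>

definition c_end :: "index \<Rightarrow> (nat \<Rightarrow> index) \<Rightarrow> level \<Rightarrow> nat \<times> level \<Rightarrow> bool" where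
  "c_end \<gamma> j l = (\<lambda>(y, m). m = l \<and> j y = \<gamma>)"

text \<open>The prime of the end \<open>(x, l)\<close> is the parity of level \<open>l\<close> at the opposite end. Parities are
  defined on lists, for arbitrary \<open>l\<close> and \<open>d\<close>, so that they can be followed through partial
  moves whose intermediate stages are not diagrams of interest.\<close>

definition c_parity ::
    "index \<Rightarrow> (nat \<Rightarrow> index) \<Rightarrow> level \<Rightarrow> (nat \<times> level) list \<Rightarrow> nat \<times> level \<Rightarrow> bool" where
  "c_parity \<gamma> j l es d = odd (length (filter (c_end \<gamma> j l) (takeWhile (\<lambda>e. e \<noteq> d) es)))"

lemma primed_c_parity: "primed \<gamma> j G (x, l) = c_parity \<gamma> j l (ends G) (x, opposite l)"
  by (simp add: primed_def c_parity_def c_end_def)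

lemma c_parity_append:
  "c_parity \<gamma> j l (us @ vs) d =
     (if d \<in> set us then c_parity \<gamma> j l us d
      else odd (length (filter (c_end \<gamma> j l) us)) \<noteq> c_parity \<gamma> j l vs d)"
  by (auto simp: c_parity_def takeWhile_append)

lemma c_parity_Cons:
  "c_parity \<gamma> j l (e # es) d = (e \<noteq> d \<and> c_end \<gamma> j l e \<noteq> c_parity \<gamma> j l es d)"
  by (auto simp: c_parity_def)

lemma c_parity_insert_block:
  assumes "even (length (filter (c_end \<gamma> j l) B))" and "d \<notin> set B"
  shows "c_parity \<gamma> j l (us @ B @ vs) d = c_parity \<gamma> j l (us @ vs) d"
  using assms by (simp add: c_parity_append)

text \<open>For the two chords of a second move: nothing that is counted lies between \<open>e\<close> and \<open>f\<close>, so
  their opposite ends receive equal primes.\<close>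

lemma c_parity_neighbours:
  assumes "\<not> c_end \<gamma> j l e" "\<not> c_end \<gamma> j l f" "e \<notin> set us" "f \<notin> set us"
  shows "c_parity \<gamma> j l (us @ e # f # vs) e = c_parity \<gamma> j l (us @ e # f # vs) f"
  using assms by (simp add: c_parity_append c_parity_Cons)

text \<open>Exchanging neighbours changes the initial segment of \<open>e\<close> by \<open>f\<close> and that of \<open>f\<close> by \<open>e\<close>;
  every other initial segment contains both or neither of them.\<close>

lemma c_parity_swap:
  assumes "distinct (us @ strand s e f @ vs)"
  shows "c_parity \<gamma> j l (us @ rev (strand s e f) @ vs) d =
    (c_parity \<gamma> j l (us @ strand s e f @ vs) d \<noteq>
      (d = e \<and> c_end \<gamma> j l f \<or> d = f \<and> c_end \<gamma> j l e))"
  using assms by (auto simp: strand_def c_parity_append c_parity_Cons)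

text \<open>The chords present on both sides of a move keep their index, so both words can be computed
  with one and the same index function; this lemma makes the change of function.\<close>

lemma word_cong:
  assumes "\<And>x. x \<in> chords G \<Longrightarrow> j x = j' x"
  shows "word \<alpha> \<beta> \<gamma> j G = word \<alpha> \<beta> \<gamma> j' G"
proof -
  have "c_parity \<gamma> j l (ends G) d = c_parity \<gamma> j' l (ends G) d" for l d
  proof -
    have "filter (c_end \<gamma> j l) (takeWhile (\<lambda>e. e \<noteq> d) (ends G)) =
          filter (c_end \<gamma> j' l) (takeWhile (\<lambda>e. e \<noteq> d) (ends G))"
      by (rule filter_cong) (use assms in \<open>force simp: c_end_def chords_def dest: set_takeWhileD\<close>)+
    then show ?thesis by (simp add: c_parity_def)
  qed
  moreover have "j x = j' x" if "(x, l) \<in> set (ends G)" for x l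
    using assms that by (force simp: chords_def)
  ultimately have "end_word \<alpha> \<beta> \<gamma> j G e = end_word \<alpha> \<beta> \<gamma> j' G e" if "e \<in> set (ends G)" for e
    using that by (cases e) (simp add: end_word_letters primed_c_parity)
  then show ?thesis by (simp add: word_def cong: map_cong)
qed


section \<open>Invariance under renaming of chords\<close>

lemma word_relabelling:
  assumes f: "relabelling f G G'"
    and ind: "\<And>x. x \<in> chords G \<Longrightarrow> j' (f x) = j x"
  shows "word \<alpha> \<beta> \<gamma> j' G' = word \<alpha> \<beta> \<gamma> j G"
proof -
  have inj: "inj_on f (chords G)" and ends: "ends G' = map (apfst f) (ends G)"
    using f by (auto simp: relabelling_def)
  have chord: "x \<in> chords G" if "(x, l) \<in> set (ends G)" for x l
    using that by (force simp: chords_def)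
  have parity: "c_parity \<gamma> j' l (ends G') (f x, m) = c_parity \<gamma> j l (ends G) (x, m)"
    if "x \<in> chords G" for x l m
  proof -
    have tw: "takeWhile (\<lambda>e. apfst f e \<noteq> (f x, m)) (ends G) = takeWhile (\<lambda>e. e \<noteq> (x, m)) (ends G)"
      by (rule takeWhile_cong) (use that chord inj in \<open>auto simp: inj_on_eq_iff\<close>)
    have fi: "filter (\<lambda>e. c_end \<gamma> j' l (apfst f e)) (takeWhile (\<lambda>e. e \<noteq> (x, m)) (ends G))
        = filter (c_end \<gamma> j l) (takeWhile (\<lambda>e. e \<noteq> (x, m)) (ends G))"
      by (rule filter_cong) (use ind chord in \<open>auto simp: c_end_def dest!: set_takeWhileD\<close>)
    show ?thesis
      using tw fi by (simp add: c_parity_def ends takeWhile_map filter_map comp_def)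
  qed
  have "end_word \<alpha> \<beta> \<gamma> j' G' (apfst f e) = end_word \<alpha> \<beta> \<gamma> j G e" if "e \<in> set (ends G)" for e
  proof (cases e)
    case (Pair x l)
    with that chord have "x \<in> chords G" by blast
    then show ?thesis by (simp add: Pair end_word_letters primed_c_parity parity ind)
  qed
  then show ?thesis
    by (simp add: word_def ends comp_def cong: map_cong)
qed


section \<open>Invariance under the first and the second move\<close>

lemma opposite_neq [simp]: "opposite l \<noteq> l" "l \<noteq> opposite l"
  by (cases l; simp)+

lemma word_R1:
  assumes gauss: "gauss_diagram G'" and "R1 p G G'" and "j p \<notin> {\<alpha>, \<beta>, \<gamma>}"
  shows "word \<alpha> \<beta> \<gamma> j G' = word \<alpha> \<beta> \<gamma> j G"
proof -
  obtain us vs l where G: "ends G = us @ vs"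
    and G': "ends G' = us @ [(p, l), (p, opposite l)] @ vs"
    using assms(2) by (auto simp: R1_def)
  have "distinct (ends G')" using gauss by (simp add: gauss_diagram_def)
  then have fresh: "x \<noteq> p" if "(x, m) \<in> set us \<union> set vs" for x m
    using that by (cases l; cases m) (auto simp: G')
  have "c_parity \<gamma> j m (ends G') (x, n) = c_parity \<gamma> j m (ends G) (x, n)" if "x \<noteq> p" for x m n
    unfolding G G' by (rule c_parity_insert_block) (use that assms(3) in \<open>auto simp: c_end_def\<close>)
  then have "end_word \<alpha> \<beta> \<gamma> j G' e = end_word \<alpha> \<beta> \<gamma> j G e" if "e \<in> set us \<union> set vs" for e
    using that fresh by (cases e) (force simp: end_word_letters primed_c_parity)
  moreover have "end_word \<alpha> \<beta> \<gamma> j G' (p, m) = []" for m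
    using assms(3) by (simp add: end_word_def)
  ultimately show ?thesis by (simp add: word_def G G' cong: map_cong)
qed

lemma word_R2:
  assumes gauss: "gauss_diagram G'" and "R2 p q G G'" and jpq: "j p = j q"
  shows "D_eq (word \<alpha> \<beta> \<gamma> j G') (word \<alpha> \<beta> \<gamma> j G)"
proof -
  obtain us vs ws l P where G: "ends G = us @ vs @ ws"
    and P: "P \<in> {[(p, opposite l), (q, opposite l)], [(q, opposite l), (p, opposite l)]}"
    and G': "ends G' = us @ [(p, l), (q, l)] @ vs @ P @ ws"
    using assms(2) unfolding R2_def by blast
  have dist: "distinct (us @ [(p, l), (q, l)] @ vs @ P @ ws)"
    using gauss by (simp add: gauss_diagram_def G')
  then have fresh: "x \<noteq> p" "x \<noteq> q" if "(x, m) \<in> set us \<union> set vs \<union> set ws" for x m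
    using that P by (cases l; cases m; auto)+
  let ?w = "end_word \<alpha> \<beta> \<gamma> j G'"
  have "c_parity \<gamma> j m (ends G') (x, n) = c_parity \<gamma> j m (ends G) (x, n)"
    if "x \<noteq> p" "x \<noteq> q" for x m n
  proof -
    have "c_parity \<gamma> j m (ends G') (x, n) = c_parity \<gamma> j m (us @ (vs @ P @ ws)) (x, n)"
      unfolding G'
      by (rule c_parity_insert_block) (use that jpq in \<open>auto simp: c_end_def\<close>)
    also have "\<dots> = c_parity \<gamma> j m ((us @ vs) @ P @ ws) (x, n)" by simp
    also have "\<dots> = c_parity \<gamma> j m ((us @ vs) @ ws) (x, n)"
      by (rule c_parity_insert_block) (use that jpq P in \<open>auto simp: c_end_def\<close>)
    finally show ?thesis by (simp add: G)
  qed
  then have other: "?w e = end_word \<alpha> \<beta> \<gamma> j G e" if "e \<in> set us \<union> set vs \<union> set ws" for e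
    using that fresh by (cases e) (force simp: end_word_letters primed_c_parity)
  have "c_parity \<gamma> j l (ends G') (p, opposite l) = c_parity \<gamma> j l (ends G') (q, opposite l)"
  proof -
    have *: "c_parity \<gamma> j l ((us @ [(p, l), (q, l)] @ vs) @ e # f # ws) e =
          c_parity \<gamma> j l ((us @ [(p, l), (q, l)] @ vs) @ e # f # ws) f"
      if "P = [e, f]" for e f
      by (rule c_parity_neighbours) (use that P dist in \<open>auto simp: c_end_def\<close>)
    from P consider (pq) "P = [(p, opposite l), (q, opposite l)]"
      | (qp) "P = [(q, opposite l), (p, opposite l)]" by blast
    then show ?thesis
    proof cases
      case pq
      show ?thesis using *[OF pq] by (simp add: G' pq)
    next
      case qp
      show ?thesis using *[OF qp] by (simp add: G' qp)
    qed
  qed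
  moreover have "c_parity \<gamma> j (opposite l) (ends G') (p, l)
      = c_parity \<gamma> j (opposite l) (ends G') (q, l)"
    unfolding G' append_Cons append_Nil
    by (rule c_parity_neighbours) (use dist in \<open>auto simp: c_end_def\<close>)
  moreover have oo: "opposite (opposite l) = l" by (cases l) auto
  ultimately have eq: "?w (p, m) = ?w (q, m)" for m
    by (cases "m = l"; cases m; cases l) (auto simp: end_word_letters primed_c_parity jpq)
  have square: "D_eq (?w (q, m) @ ?w (q, m)) []" for m
    unfolding end_word_letters by (rule D_eq_letters_square)
  (* each of the two inserted blocks is a letter written twice, or empty *)
  have P1: "D_eq (concat (map ?w [(p, l), (q, l)])) []"
    using square by (simp add: eq)
  have P2: "D_eq (concat (map ?w P)) []"
    using square P by (auto simp: eq)
  have "D_eq (concat (map ?w us) @ concat (map ?w [(p, l), (q, l)]) @ concat (map ?w vs)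
            @ concat (map ?w P) @ concat (map ?w ws))
          (concat (map ?w us) @ [] @ concat (map ?w vs) @ [] @ concat (map ?w ws))"
    by (intro D_eq_append D_eq_refl P1 P2)
  then show ?thesis
    using other by (simp add: word_def G G' cong: map_cong)
qed


section \<open>Invariance under the third move\<close>

text \<open>The case distinction behind the third move. For the top strand, \<open>i\<close>, \<open>k\<close>, \<open>m\<close> are the indices
  of \<open>p\<close>, \<open>q\<close>, \<open>r\<close>: the left side says that an end with a letter changes its prime, the right side
  that an \<open>\<alpha>\<close>-letter and a \<open>\<beta>\<close>-letter of the same level are exchanged, which costs one prime.\<close>

lemma index_sum_cases:
  fixes \<alpha> \<beta> \<gamma> i k m :: index
  assumes "distinct [0, \<alpha>, \<beta>, \<gamma>]" and "i + k + m = 0"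
  shows "m = \<gamma> \<and> i \<in> {\<alpha>, \<beta>} \<longleftrightarrow> {i, k} = {\<alpha>, \<beta>}"
proof -
  have self: "x + x = 0" for x :: index
    by (simp add: prod_eq_iff)
  have cancel: "x + (x + y) = y" for x y :: index
    using self[of x] by (simp flip: add.assoc)
  have abc: "\<alpha> + \<beta> = \<gamma>"
    using assms(1)
    by (cases "fst \<alpha>"; cases "snd \<alpha>"; cases "fst \<beta>"; cases "snd \<beta>"; cases "fst \<gamma>"; cases "snd \<gamma>";
      simp add: prod_eq_iff)
  have m: "m = i + k" and k: "k = i + m"
    using assms(2) cancel[of "i + k" m] cancel[of i k] by simp_all
  have "k = \<beta>" if "m = \<gamma>" "i = \<alpha>"
    using that cancel[of \<alpha> \<beta>] by (simp add: k abc)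
  moreover have "k = \<alpha>" if "m = \<gamma>" "i = \<beta>"
    using that cancel[of \<beta> \<alpha>] abc by (simp add: k add.commute)
  moreover have "m = \<gamma>" if "i = \<alpha> \<and> k = \<beta> \<or> i = \<beta> \<and> k = \<alpha>"
    using that abc by (auto simp: m add.commute)
  ultimately show ?thesis
    unfolding doubleton_eq_iff insert_iff empty_iff by argo
qed

lemma three_elements_cases:
  assumes "{X, Y, Z} = {A, B, C}" "distinct [A, B, C]"
  obtains "X = A" "Y = B" "Z = C" | "X = A" "Y = C" "Z = B" | "X = B" "Y = A" "Z = C"
    | "X = B" "Y = C" "Z = A" | "X = C" "Y = A" "Z = B" | "X = C" "Y = B" "Z = A"
proof -
  have "X \<in> {A, B, C}" "Y \<in> {A, B, C}" "Z \<in> {A, B, C}"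
    "A \<in> {X, Y, Z}" "B \<in> {X, Y, Z}" "C \<in> {X, Y, Z}"
    using assms(1) by blast+
  with assms(2) that show thesis by auto
qed

text \<open>The move is performed strand by strand. Each exchange can change a parity only at one of the
  exchanged ends, and the levels match only on the middle strand, where the under-end of \<open>p\<close> meets
  the over-end of \<open>r\<close>. Since the changes add up independently of their order, the order of the
  strands on the line does not matter.\<close>

lemma primed_R3:
  assumes gauss: "gauss_diagram G" and R3: "R3 p q r G G'"
  shows "primed \<gamma> j G' (x, l) = (primed \<gamma> j G (x, l) \<noteq>
           ((x, l) = (p, Over) \<and> j r = \<gamma> \<or> (x, l) = (r, Under) \<and> j p = \<gamma>))"
proof -
  obtain s us vs ws zs X Y Z where pqr: "distinct [p, q, r]"
    and XYZ: "{X, Y, Z} = {strand (s * sign G r) (p, Over) (q, Over),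
                     strand (s * sign G q) (p, Under) (r, Over),
                     strand (s * sign G p) (q, Under) (r, Under)}"
    and G: "ends G = us @ X @ vs @ Y @ ws @ Z @ zs"
    and G': "ends G' = us @ rev X @ vs @ rev Y @ ws @ rev Z @ zs"
    using R3 unfolding R3_def by blast
  have dist: "distinct (us @ X @ vs @ Y @ ws @ Z @ zs)"
    using gauss by (simp add: gauss_diagram_def G)
  have step: "c_parity \<gamma> j l (us @ rev X @ vs @ rev Y @ ws @ rev Z @ zs) d =
    (c_parity \<gamma> j l (us @ X @ vs @ Y @ ws @ Z @ zs) d \<noteq>
      ((d = e1 \<and> c_end \<gamma> j l f1 \<or> d = f1 \<and> c_end \<gamma> j l e1) \<noteq>
      ((d = e2 \<and> c_end \<gamma> j l f2 \<or> d = f2 \<and> c_end \<gamma> j l e2) \<noteq>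
      (d = e3 \<and> c_end \<gamma> j l f3 \<or> d = f3 \<and> c_end \<gamma> j l e3))))"
    if "X = strand t1 e1 f1" "Y = strand t2 e2 f2" "Z = strand t3 e3 f3"
    for t1 t2 t3 e1 e2 e3 f1 f2 f3 d l
  proof -
    have "c_parity \<gamma> j l (us @ rev X @ vs @ Y @ ws @ Z @ zs) d =
      (c_parity \<gamma> j l (us @ X @ vs @ Y @ ws @ Z @ zs) d \<noteq>
        (d = e1 \<and> c_end \<gamma> j l f1 \<or> d = f1 \<and> c_end \<gamma> j l e1))"
      unfolding that(1) by (rule c_parity_swap) (use dist in \<open>simp add: that(1)\<close>)
    moreover have "c_parity \<gamma> j l ((us @ rev X @ vs) @ rev Y @ ws @ Z @ zs) d =
      (c_parity \<gamma> j l ((us @ rev X @ vs) @ Y @ ws @ Z @ zs) d \<noteq>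
        (d = e2 \<and> c_end \<gamma> j l f2 \<or> d = f2 \<and> c_end \<gamma> j l e2))"
      unfolding that(2) by (rule c_parity_swap) (use dist in \<open>auto simp: that(2)\<close>)
    moreover have "c_parity \<gamma> j l ((us @ rev X @ vs @ rev Y @ ws) @ rev Z @ zs) d =
      (c_parity \<gamma> j l ((us @ rev X @ vs @ rev Y @ ws) @ Z @ zs) d \<noteq>
        (d = e3 \<and> c_end \<gamma> j l f3 \<or> d = f3 \<and> c_end \<gamma> j l e3))"
      unfolding that(3) by (rule c_parity_swap) (use dist in \<open>auto simp: that(3)\<close>)
    ultimately show ?thesis unfolding append_assoc by argo
  qed
  have "distinct [strand (s * sign G r) (p, Over) (q, Over),
                     strand (s * sign G q) (p, Under) (r, Over),
                     strand (s * sign G p) (q, Under) (r, Under)]" (is "distinct [?A, ?B, ?C]")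
    using pqr by (simp add: strand_def)
  from three_elements_cases[OF XYZ this] show ?thesis
  proof cases
    case 1
    show ?thesis unfolding primed_c_parity G G' step[OF 1] using pqr
      by (cases l) (auto simp: c_end_def)
  next
    case 2
    show ?thesis unfolding primed_c_parity G G' step[OF 2] using pqr
      by (cases l) (auto simp: c_end_def)
  next
    case 3
    show ?thesis unfolding primed_c_parity G G' step[OF 3] using pqr
      by (cases l) (auto simp: c_end_def)
  next
    case 4
    show ?thesis unfolding primed_c_parity G G' step[OF 4] using pqr
      by (cases l) (auto simp: c_end_def)
  next
    case 5
    show ?thesis unfolding primed_c_parity G G' step[OF 5] using pqr
      by (cases l) (auto simp: c_end_def)
  next
    case 6
    show ?thesis unfolding primed_c_parity G G' step[OF 6] using pqr
      by (cases l) (auto simp: c_end_def)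
  qed
qed

text \<open>The line is cut into the three strands and the pieces between them. The only ends that may
  change their primes lie on the strands, so the outer pieces have the same letters before and
  after; each strand is settled by \<open>D_eq_letters_swap\<close>, and \<open>index_sum_cases\<close> supplies its
  hypothesis.\<close>

lemma word_R3:
  assumes gauss: "gauss_diagram G" and R3: "R3 p q r G G'"
    and abc: "distinct [0, \<alpha>, \<beta>, \<gamma>]" and sum: "j p + j q + j r = 0"
  shows "D_eq (word \<alpha> \<beta> \<gamma> j G) (word \<alpha> \<beta> \<gamma> j G')"
proof -
  obtain s us vs ws zs X Y Z where pqr: "distinct [p, q, r]"
    and XYZ: "{X, Y, Z} = {strand (s * sign G r) (p, Over) (q, Over),
                     strand (s * sign G q) (p, Under) (r, Over),
                     strand (s * sign G p) (q, Under) (r, Under)}"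
    and G: "ends G = us @ X @ vs @ Y @ ws @ Z @ zs"
    and G': "ends G' = us @ rev X @ vs @ rev Y @ ws @ rev Z @ zs"
    using R3 unfolding R3_def by blast
  have dist: "distinct (us @ X @ vs @ Y @ ws @ Z @ zs)"
    using gauss by (simp add: gauss_diagram_def G)
  let ?w = "end_word \<alpha> \<beta> \<gamma> j G" and ?w' = "end_word \<alpha> \<beta> \<gamma> j G'"
  have primed: "primed \<gamma> j G' (x, l) = (primed \<gamma> j G (x, l) \<noteq>
           ((x, l) = (p, Over) \<and> j r = \<gamma> \<or> (x, l) = (r, Under) \<and> j p = \<gamma>))" for x l
    by (rule primed_R3[OF gauss R3])
  have "(p, Over) \<in> set X \<union> set Y \<union> set Z \<and> (r, Under) \<in> set X \<union> set Y \<union> set Z"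
  proof -
    have "set X \<union> set Y \<union> set Z = \<Union> (set ` {X, Y, Z})" by auto
    also have "\<dots> \<supseteq> {(p, Over), (r, Under)}" unfolding XYZ by (auto simp: strand_def)
    finally show ?thesis by simp
  qed
  then have out: "e \<noteq> (p, Over) \<and> e \<noteq> (r, Under)"
    if "e \<in> set us \<union> set vs \<union> set ws \<union> set zs" for e
    using that dist by auto
  have other: "?w' e = ?w e" if "e \<in> set us \<union> set vs \<union> set ws \<union> set zs" for e
    using out[OF that] by (cases e) (auto simp: end_word_letters primed)
  have strandI: "D_eq (concat (map ?w (strand t e f))) (concat (map ?w' (rev (strand t e f))))"
    if "D_eq (?w e @ ?w f) (?w' f @ ?w' e)" "D_eq (?w f @ ?w e) (?w' e @ ?w' f)" for t e f
    using that by (simp add: strand_def)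
  have ab: "\<alpha> \<noteq> \<beta>" using abc by simp
  (* top strand: the chords p and q; the prime of the over-end of p depends on r *)
  have pq: "j r = \<gamma> \<and> j p \<in> {\<alpha>, \<beta>} \<longleftrightarrow> {j p, j q} = {\<alpha>, \<beta>}"
    by (rule index_sum_cases[OF abc sum])
  (* bottom strand: the chords q and r; the prime of the under-end of r depends on p *)
  have qr: "j p = \<gamma> \<and> j r \<in> {\<alpha>, \<beta>} \<longleftrightarrow> {j q, j r} = {\<alpha>, \<beta>}"
    using index_sum_cases[OF abc, of "j r" "j q" "j p"] sum by (simp add: ac_simps insert_commute)
  have block: "D_eq (concat (map ?w B)) (concat (map ?w' (rev B)))" if "B \<in> {X, Y, Z}" for B
  proof -
    from that[unfolded XYZ] consider
        (top) "B = strand (s * sign G r) (p, Over) (q, Over)"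
      | (middle) "B = strand (s * sign G q) (p, Under) (r, Over)"
      | (bottom) "B = strand (s * sign G p) (q, Under) (r, Under)" by blast
    then show ?thesis
    proof cases
      case top
      show ?thesis unfolding top
        by (intro strandI; unfold end_word_letters; intro D_eq_letters_swap ab)
           (use pq pqr in \<open>auto simp: primed insert_commute\<close>)
    next
      case middle
      show ?thesis unfolding middle
        by (intro strandI; unfold end_word_letters; intro D_eq_letters_swap ab)
           (use pqr in \<open>auto simp: primed\<close>)
    next
      case bottom
      show ?thesis unfolding bottom
        by (intro strandI; unfold end_word_letters; intro D_eq_letters_swap ab)
           (use qr pqr in \<open>auto simp: primed insert_commute\<close>)
    qed
  qed
  have "D_eq (concat (map ?w us) @ concat (map ?w X) @ concat (map ?w vs) @ concat (map ?w Y)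
            @ concat (map ?w ws) @ concat (map ?w Z) @ concat (map ?w zs))
          (concat (map ?w us) @ concat (map ?w' (rev X)) @ concat (map ?w vs)
            @ concat (map ?w' (rev Y)) @ concat (map ?w ws) @ concat (map ?w' (rev Z))
            @ concat (map ?w zs))"
    by (intro D_eq_append D_eq_refl block) simp_all
  then show ?thesis
    using other by (simp add: word_def G G' cong: map_cong)
qed


section \<open>The invariant\<close>

lemma w_elementary_step:
  assumes T: "two_parity_theory T ind" and abc: "distinct [0, \<alpha>, \<beta>, \<gamma>]"
    and step: "elementary_step T G G'"
  shows "w \<alpha> \<beta> \<gamma> (ind G) G = w \<alpha> \<beta> \<gamma> (ind G') G'"
proof -
  interpret two_parity_theory T ind by (fact T)
  have GT: "G \<in> T" "G' \<in> T" using step by (simp_all add: elementary_step_def)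
  have "D_eq (word \<alpha> \<beta> \<gamma> (ind G) G) (word \<alpha> \<beta> \<gamma> (ind G') G')"
    using step unfolding elementary_step_def
  proof (elim conjE disjE exE)
    fix f assume "relabelling f G G'"
    then show ?thesis
      using word_relabelling ind_relabelling[OF GT] by simp
  next
    fix p assume R1: "R1 p G G'"
    have "word \<alpha> \<beta> \<gamma> (ind G') G' = word \<alpha> \<beta> \<gamma> (ind G') G"
      using word_R1[OF diagrams[OF GT(2)] R1] ind_R1[OF GT R1] abc by simp
    also have "\<dots> = word \<alpha> \<beta> \<gamma> (ind G) G"
      by (rule word_cong) (rule ind_R1_other[OF GT R1])
    finally show ?thesis by simp
  next
    fix p q assume R2: "R2 p q G G'"
    have "word \<alpha> \<beta> \<gamma> (ind G') G = word \<alpha> \<beta> \<gamma> (ind G) G"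
      by (rule word_cong) (rule ind_R2_other[OF GT R2])
    then show ?thesis
      using word_R2[OF diagrams[OF GT(2)] R2 ind_R2[OF GT R2], of \<alpha> \<beta> \<gamma>]
      by (simp add: D_eq_sym)
  next
    fix p q r assume R3: "R3 p q r G G'"
    have "chords G' = chords G"
      using R3 unfolding R3_def chords_def by (elim conjE exE) simp
    then have "word \<alpha> \<beta> \<gamma> (ind G') G' = word \<alpha> \<beta> \<gamma> (ind G) G'"
      using ind_R3_same[OF GT R3] by (intro word_cong) simp
    then show ?thesis
      using word_R3[OF diagrams[OF GT(1)] R3 abc ind_R3[OF GT R3]] by simp
  qed
  then show ?thesis by (simp add: w_def D_element_eq_iff)
qed

theorem theorem1:
  fixes T :: "diagram set" and ind :: "diagram \<Rightarrow> nat \<Rightarrow> index" and \<alpha> \<beta> \<gamma> :: index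
    and G G' :: diagram
  assumes "two_parity_theory T ind"
    and "distinct [0, \<alpha>, \<beta>, \<gamma>]"
    and "G \<in> T" and "G' \<in> T"
    and "equivalent_in T G G'"
  shows "w \<alpha> \<beta> \<gamma> (ind G) G \<in> carrier D \<and> w \<alpha> \<beta> \<gamma> (ind G) G = w \<alpha> \<beta> \<gamma> (ind G') G'"
proof
  show "w \<alpha> \<beta> \<gamma> (ind G) G \<in> carrier D"
    by (simp add: w_def D_element_def D_def presented_group_def)
  have "equivclp (elementary_step T) G G'"
    using assms(5) by (simp add: equivalent_in_def)
  then show "w \<alpha> \<beta> \<gamma> (ind G) G = w \<alpha> \<beta> \<gamma> (ind G') G'"
  proof (induction rule: equivclp_induct)
    case base
    show ?case ..
  next
    case (step H H')
    then show ?case using w_elementary_step[OF assms(1,2)] by metis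
  qed
qed

end
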